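(* For every $k \geq 2$, $$\frac{k(k-1)}{4} \leq AR_s(P_{k-1}) \quad\text{and}\quad AR_s(M_k) = \binom{k+1}{2},$$ and for every $k\geq 3$, $$AR_s(P_{k-1}) \leq AR_s(C_k) \leq k^2.$$
   Context: All graphs are finite and simple. $P_k$ is the path with $k$ edges, $C_k$ the cycle with $k$ edges, $M_k$ the matching with $k$ edges. An edge-coloring is proper if adjacent edges receive distinct colors; an edge-colored graph is rainbow if all its edges have distinct colors. A copy of $H$ is a (not necessarily induced) subgraph isomorphic to $H$. $AR_s(H)$ is the smallest number of edges in a graph $G$ such that every proper edge-coloring of $G$ contains a rainbow copy of $H$. *)

theory Defs
  imports Complex_Main
begin

record 'a ugraph =
  verts :: "'a set"
  edges :: "'a set set"

definition simple_graph :: "'a ugraph \<Rightarrow> bool" where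
  "simple_graph G \<longleftrightarrow> finite (verts G) \<and> (\<forall>e\<in>edges G. e \<subseteq> verts G \<and> card e = 2)"

definition subgraph :: "'a ugraph \<Rightarrow> 'a ugraph \<Rightarrow> bool" where
  "subgraph K G \<longleftrightarrow> simple_graph K \<and> verts K \<subseteq> verts G \<and> edges K \<subseteq> edges G"

definition graph_iso :: "'a ugraph \<Rightarrow> 'b ugraph \<Rightarrow> bool" where
  "graph_iso G H \<longleftrightarrow> (\<exists>f. bij_betw f (verts G) (verts H) \<and>
     (\<forall>u\<in>verts G. \<forall>v\<in>verts G. {u, v} \<in> edges G \<longleftrightarrow> {f u, f v} \<in> edges H))"

definition is_copy :: "'a ugraph \<Rightarrow> 'b ugraph \<Rightarrow> 'a ugraph \<Rightarrow> bool" where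
  "is_copy K H G \<longleftrightarrow> subgraph K G \<and> graph_iso K H"

definition proper_edge_coloring :: "'a ugraph \<Rightarrow> ('a set \<Rightarrow> 'c) \<Rightarrow> bool" where
  "proper_edge_coloring G c \<longleftrightarrow>
     (\<forall>e\<in>edges G. \<forall>e'\<in>edges G. e \<noteq> e' \<and> e \<inter> e' \<noteq> {} \<longrightarrow> c e \<noteq> c e')"

definition rainbow :: "'a ugraph \<Rightarrow> ('a set \<Rightarrow> 'c) \<Rightarrow> bool" where
  "rainbow K c \<longleftrightarrow> inj_on c (edges K)"

text \<open>Graphs are finite, so it is no restriction to take vertices and colors to be
  natural numbers.\<close>

definition forces_rainbow :: "nat ugraph \<Rightarrow> 'b ugraph \<Rightarrow> bool" where
  "forces_rainbow G H \<longleftrightarrow>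
     (\<forall>c :: nat set \<Rightarrow> nat. proper_edge_coloring G c \<longrightarrow> (\<exists>K. is_copy K H G \<and> rainbow K c))"

definition AR_s :: "'b ugraph \<Rightarrow> nat" where
  "AR_s H = (LEAST m. \<exists>G :: nat ugraph. simple_graph G \<and> card (edges G) = m \<and> forces_rainbow G H)"

text \<open>The index counts edges, so the path has \<open>k + 1\<close> vertices.\<close>

definition path_graph :: "nat \<Rightarrow> nat ugraph" where
  "path_graph k = \<lparr>verts = {0..k}, edges = {{i, i + 1} | i. i < k}\<rparr>"

text \<open>Only meaningful as a cycle for \<open>k \<ge> 3\<close>.\<close>

definition cycle_graph :: "nat \<Rightarrow> nat ugraph" where
  "cycle_graph k = \<lparr>verts = {0..<k}, edges = {{i, (i + 1) mod k} | i. i < k}\<rparr>"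

definition matching_graph :: "nat \<Rightarrow> nat ugraph" where
  "matching_graph k = \<lparr>verts = {0..<2 * k}, edges = {{2 * i, 2 * i + 1} | i. i < k}\<rparr>"

end

theory Submission
  imports Defs "HOL-Library.Nat_Bijection"
begin

text \<open>
  Lower bounds: color \<open>G\<close> greedily, color class \<open>j\<close> being a maximum matching among the
  edges not in the classes \<open>0, \<dots>, j - 1\<close>. If a rainbow subgraph has \<open>r\<close> edges, at least
  \<open>r - j\<close> of them have color at least \<open>j\<close>; if it is a union of \<open>q\<close> matchings, then class \<open>j\<close>
  has at least \<open>(r - j) / q\<close> edges, and summing over \<open>j\<close> gives \<open>q |E(G)| \<ge> r (r + 1) / 2\<close>.

  Upper bounds: disjoint stars with \<open>1, \<dots>, k\<close> edges contain a rainbow \<open>M\<^sub>k\<close>, chosen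
  greedily from the smallest star on. For \<open>C\<^sub>k\<close>, the even positions of the cycle are fixed in
  advance, and the odd positions are filled one after the other. The \<open>i\<close>-th choice excludes
  at most \<open>5 i + 2\<close> vertices, hence the \<open>i\<close>-th fixed vertex needs only about \<open>5 i\<close> neighbors
  (except where the cycle closes), for a total of about \<open>5 k\<^sup>2 / 8\<close> edges.
\<close>

section \<open>Copies\<close>

text \<open>By \<open>is_copy_map_graph\<close> and \<open>is_copyE\<close>, copies of
  \<open>H\<close> are exactly such images under injections, so later arguments handle vertex maps
  instead of subgraphs with an isomorphism.\<close>

definition map_graph :: "('b \<Rightarrow> 'a) \<Rightarrow> 'b ugraph \<Rightarrow> 'a ugraph" where
  "map_graph g H = \<lparr>verts = g ` verts H, edges = (`) g ` edges H\<rparr>"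

lemma simple_graph_finite_edges:
  assumes "simple_graph G"
  shows "finite (edges G)"
proof -
  have "edges G \<subseteq> Pow (verts G)"
    using assms by (auto simp: simple_graph_def)
  then show ?thesis
    using assms by (meson finite_Pow_iff finite_subset simple_graph_def)
qed

lemma is_copy_map_graph:
  assumes H: "simple_graph H" and inj: "inj_on g (verts H)"
    and vs: "g ` verts H \<subseteq> verts G" and es: "(`) g ` edges H \<subseteq> edges G"
  shows "is_copy (map_graph g H) H G"
proof -
  have sub: "e \<subseteq> verts H" "card e = 2" if "e \<in> edges H" for e
    using H that by (auto simp: simple_graph_def)
  have "card (g ` e) = 2" if "e \<in> edges H" for e
    using sub[OF that] inj by (metis card_image inj_on_subset)
  then have simple: "simple_graph (map_graph g H)"
    using H sub by (auto simp: simple_graph_def map_graph_def)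
  let ?f = "the_inv_into (verts H) g"
  have "{g a, g b} \<in> (`) g ` edges H \<longleftrightarrow> {a, b} \<in> edges H"
    if "a \<in> verts H" "b \<in> verts H" for a b
  proof
    assume "{g a, g b} \<in> (`) g ` edges H"
    then obtain e where e: "e \<in> edges H" "g ` {a, b} = g ` e" by auto
    then have "{a, b} = e"
      using inj_on_image_eq_iff[OF inj, of "{a, b}" e] sub(1)[OF e(1)] that by simp
    with e show "{a, b} \<in> edges H" by simp
  next
    assume "{a, b} \<in> edges H"
    then have "g ` {a, b} \<in> (`) g ` edges H" by blast
    then show "{g a, g b} \<in> (`) g ` edges H" by simp
  qed
  moreover have "bij_betw ?f (g ` verts H) (verts H)"
    using inj by (simp add: bij_betw_the_inv_into inj_on_imp_bij_betw)
  ultimately have "graph_iso (map_graph g H) H"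
    unfolding graph_iso_def
    by (intro exI[of _ ?f]) (auto simp: map_graph_def the_inv_into_f_f[OF inj])
  with simple vs es show ?thesis
    by (simp add: is_copy_def subgraph_def map_graph_def)
qed

lemma is_copyE:
  assumes K: "is_copy K H G" and H: "simple_graph H"
  obtains g where "inj_on g (verts H)" "K = map_graph g H"
proof -
  from K obtain f where f: "bij_betw f (verts K) (verts H)"
    and iff: "\<And>u v. u \<in> verts K \<Longrightarrow> v \<in> verts K \<Longrightarrow>
      {u, v} \<in> edges K \<longleftrightarrow> {f u, f v} \<in> edges H"
    by (auto simp: is_copy_def graph_iso_def)
  have simple: "simple_graph K"
    using K by (simp add: is_copy_def subgraph_def)
  let ?g = "the_inv_into (verts K) f"
  have g: "bij_betw ?g (verts H) (verts K)"
    using f by (rule bij_betw_the_inv_into)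
  have gf: "?g (f u) = u" if "u \<in> verts K" for u
    using f that by (simp add: bij_betw_def the_inv_into_f_f)
  have fg: "f (?g a) = a" if "a \<in> verts H" for a
    using f that by (simp add: f_the_inv_into_f_bij_betw)
  have "edges K = (`) ?g ` edges H"
  proof (intro equalityI subsetI)
    fix e assume e: "e \<in> edges K"
    then obtain u v where uv: "e = {u, v}" "u \<in> verts K" "v \<in> verts K"
      using simple by (auto simp: simple_graph_def card_2_iff)
    then have "{f u, f v} \<in> edges H" using e iff by simp
    moreover have "e = ?g ` {f u, f v}" using uv gf by simp
    ultimately show "e \<in> (`) ?g ` edges H" by blast
  next
    fix e assume "e \<in> (`) ?g ` edges H"
    then obtain d where d: "d \<in> edges H" "e = ?g ` d" by auto
    then obtain a b where ab: "d = {a, b}" "a \<in> verts H" "b \<in> verts H"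
      using H by (auto simp: simple_graph_def card_2_iff)
    then have "?g a \<in> verts K" "?g b \<in> verts K"
      using g by (auto simp: bij_betw_def)
    then show "e \<in> edges K"
      using iff[of "?g a" "?g b"] d ab fg by simp
  qed
  moreover have "verts K = ?g ` verts H"
    using g by (simp add: bij_betw_def)
  ultimately have "K = map_graph ?g H"
    by (simp add: map_graph_def)
  then show ?thesis
    using g that by (auto simp: bij_betw_def)
qed

text \<open>The embedding of \<open>H\<close> restricts to \<open>H'\<close>, and injectivity of the
  coloring passes to fewer edges. This transfers the result for cycles to paths.\<close>

lemma forces_rainbow_subgraph:
  assumes F: "forces_rainbow G H" and sub: "subgraph H' H" and H: "simple_graph H"
  shows "forces_rainbow G H'"
  unfolding forces_rainbow_def
proof (intro allI impI)
  fix c :: "nat set \<Rightarrow> nat"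
  assume "proper_edge_coloring G c"
  then obtain K where K: "is_copy K H G" "rainbow K c"
    using F by (auto simp: forces_rainbow_def)
  then obtain g where g: "inj_on g (verts H)" "K = map_graph g H"
    using is_copyE[OF _ H] by metis
  have KG: "verts K \<subseteq> verts G" "edges K \<subseteq> edges G"
    using K by (auto simp: is_copy_def subgraph_def)
  have H': "simple_graph H'" "verts H' \<subseteq> verts H" "edges H' \<subseteq> edges H"
    using sub by (auto simp: subgraph_def)
  have "is_copy (map_graph g H') H' G"
  proof (rule is_copy_map_graph)
    show "inj_on g (verts H')" using g H' inj_on_subset by blast
    show "g ` verts H' \<subseteq> verts G" using KG(1) g(2) H'(2) by (auto simp: map_graph_def)
    show "(`) g ` edges H' \<subseteq> edges G" using KG(2) g(2) H'(3) by (auto simp: map_graph_def)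
  qed (rule H'(1))
  moreover have "rainbow (map_graph g H') c"
    using K(2) H' unfolding rainbow_def g(2) map_graph_def
    by (auto elim!: inj_on_subset)
  ultimately show "\<exists>K. is_copy K H' G \<and> rainbow K c" by blast
qed

section \<open>Lower bounds\<close>

text \<open>Induction on \<open>card E\<close>: a maximum matching \<open>M\<close> gets color 0,
  and the coloring of \<open>E - M\<close> is shifted up by one.\<close>

lemma greedy_coloring_exists:
  assumes "finite E"
  shows "\<exists>c :: 'a set \<Rightarrow> nat.
    (\<forall>e\<in>E. \<forall>e'\<in>E. e \<noteq> e' \<and> e \<inter> e' \<noteq> {} \<longrightarrow> c e \<noteq> c e') \<and>
    (\<forall>j N. N \<subseteq> E \<and> (\<forall>e\<in>N. j \<le> c e) \<and> pairwise disjnt N \<longrightarrow>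
       card N \<le> card {e \<in> E. c e = j})"
  using assms
proof (induction "card E" arbitrary: E rule: less_induct)
  case less
  show ?case
  proof (cases "E = {}")
    case True
    then show ?thesis by auto
  next
    case False
    then obtain e0 where e0: "e0 \<in> E" by blast
    let ?P = "\<lambda>N. N \<subseteq> E \<and> pairwise disjnt N"
    have "?P {e0}" using e0 by simp
    moreover have "\<forall>N. ?P N \<longrightarrow> card N < Suc (card E)"
      using less.prems by (simp add: card_mono less_Suc_eq_le)
    ultimately obtain M where M: "?P M" and M_max: "\<And>N. ?P N \<Longrightarrow> card N \<le> card M"
      using ex_has_greatest_nat[of ?P "{e0}" card "Suc (card E)"] by blast
    \<comment> \<open>A single edge is already a matching; this makes \<open>E - M\<close> strictly
      smaller.\<close>
    have "M \<noteq> {}"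
      using M_max[OF \<open>?P {e0}\<close>] by auto
    then have "E - M \<subset> E" using M by blast
    then have "card (E - M) < card E"
      using less.prems by (simp add: psubset_card_mono)
    from less.hyps[OF this finite_Diff[OF less.prems]] obtain c :: "'a set \<Rightarrow> nat" where
      proper: "\<forall>e\<in>E - M. \<forall>e'\<in>E - M. e \<noteq> e' \<and> e \<inter> e' \<noteq> {} \<longrightarrow> c e \<noteq> c e'"
      and max: "\<forall>j N. N \<subseteq> E - M \<and> (\<forall>e\<in>N. j \<le> c e) \<and> pairwise disjnt N \<longrightarrow>
        card N \<le> card {e \<in> E - M. c e = j}"
      by (elim exE conjE)
    let ?c = "\<lambda>e. if e \<in> M then 0 else Suc (c e)"
    have "?c e \<noteq> ?c e'" if "e \<in> E" "e' \<in> E" "e \<noteq> e'" "e \<inter> e' \<noteq> {}" for e e'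
    proof (cases "e \<in> M \<and> e' \<in> M")
      case True
      then have "disjnt e e'" using M that by (simp add: pairwise_def)
      with that show ?thesis by (simp add: disjnt_def)
    next
      case False
      with that proper show ?thesis by auto
    qed
    moreover have "card N \<le> card {e \<in> E. ?c e = j}"
      if N: "N \<subseteq> E" "\<forall>e\<in>N. j \<le> ?c e" "pairwise disjnt N" for j N
    proof (cases j)
      case 0
      have "{e \<in> E. ?c e = j} = M" using M 0 by auto
      then show ?thesis using M_max N by simp
    next
      case (Suc i)
      \<comment> \<open>Edges of positive color lie outside \<open>M\<close>, so the claim is the
        induction hypothesis with the color lowered by one.\<close>
      have "{e \<in> E. ?c e = j} = {e \<in> E - M. c e = i}" using Suc by auto
      moreover have "N \<subseteq> E - M" "\<forall>e\<in>N. i \<le> c e"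
        using N Suc by (force split: if_splits)+
      ultimately show ?thesis using max N by simp
    qed
    ultimately show ?thesis
      by (intro exI[of _ ?c] conjI ballI allI impI) (blast, (elim conjE, blast))
  qed
qed

lemma sum_diff_choose_two: "(\<Sum>j<r. r - j) = (r + 1) choose 2"
proof (induction r)
  case (Suc r)
  have "(\<Sum>j<Suc r. Suc r - j) = Suc r + (\<Sum>j<r. r - j)"
    by (subst sum.lessThan_Suc_shift) simp
  with Suc show ?case by (simp add: numeral_2_eq_2)
qed (simp add: numeral_2_eq_2)

text \<open>Applied with \<open>q = 2\<close> to paths and \<open>q = 1\<close> to matchings. The
  sets \<open>N i\<close> may overlap, since they enter only through a union bound.\<close>

lemma forces_rainbow_card_edges:
  fixes G :: "nat ugraph"
  assumes G: "simple_graph G" and F: "forces_rainbow G H" and H: "simple_graph H"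
    and cover: "edges H = (\<Union>i<q. N i)"
    and match: "\<And>i. i < q \<Longrightarrow> pairwise disjnt (N i)"
  shows "(card (edges H) + 1) choose 2 \<le> q * card (edges G)"
proof -
  note finG = simple_graph_finite_edges[OF G]
  obtain c :: "nat set \<Rightarrow> nat" where proper: "proper_edge_coloring G c" and
    max: "\<forall>j M. M \<subseteq> edges G \<and> (\<forall>e\<in>M. j \<le> c e) \<and> pairwise disjnt M \<longrightarrow>
       card M \<le> card {e \<in> edges G. c e = j}"
    using greedy_coloring_exists[OF finG] unfolding proper_edge_coloring_def by (elim exE conjE)
  from F proper obtain K where K: "is_copy K H G" "rainbow K c"
    by (auto simp: forces_rainbow_def)
  obtain g where g: "inj_on g (verts H)" "K = map_graph g H"
    using is_copyE[OF K(1) H] .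
  have KG: "edges K \<subseteq> edges G" and finK: "finite (edges K)"
    using K(1) by (auto simp: is_copy_def subgraph_def simple_graph_finite_edges)
  have edgesK: "edges K = (`) g ` edges H"
    using g by (simp add: map_graph_def)
  have sub: "e \<subseteq> verts H" if "e \<in> edges H" for e
    using H that by (auto simp: simple_graph_def)
  have "inj_on ((`) g) (edges H)"
    using sub g(1) by (intro inj_on_image) (metis Union_least inj_on_subset)
  then have r: "card (edges K) = card (edges H)"
    by (simp add: edgesK card_image)
  let ?r = "card (edges H)"
  let ?N = "\<lambda>i. (`) g ` N i"
  have matchK: "pairwise disjnt (?N i)" if "i < q" for i
  proof (rule pairwiseI)
    fix x y assume "x \<in> ?N i" "y \<in> ?N i" "x \<noteq> y"
    then obtain d e where de: "d \<in> N i" "e \<in> N i" "x = g ` d" "y = g ` e" "d \<noteq> e" by blast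
    then have "d \<inter> e = {}"
      using match[OF that] by (auto simp: pairwise_def disjnt_def)
    moreover have "d \<subseteq> verts H" "e \<subseteq> verts H"
      using sub cover de that by blast+
    ultimately show "disjnt x y"
      using de g(1) by (metis disjnt_def image_empty inj_on_image_Int)
  qed
  have large: "?r - j \<le> q * card {e \<in> edges G. c e = j}" for j
  proof -
    let ?T = "{e \<in> edges K. j \<le> c e}"
    \<comment> \<open>In the rainbow graph \<open>K\<close> each of the \<open>j\<close> colors
      below \<open>j\<close> occurs at most once. The remaining edges split into \<open>q\<close>
      matchings, each bounded by class \<open>j\<close> through \<open>max\<close>.\<close>
    have "card {e \<in> edges K. c e < j} \<le> card {..<j}"
      using K(2) by (intro card_inj_on_le[of c]) (auto simp: rainbow_def inj_on_def)
    moreover have "card (edges K) = card ?T + card {e \<in> edges K. c e < j}"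
    proof -
      have "edges K = ?T \<union> {e \<in> edges K. c e < j}" by auto
      moreover have "?T \<inter> {e \<in> edges K. c e < j} = {}" by auto
      ultimately show ?thesis
        using finK by (metis (no_types, lifting) card_Un_disjoint finite_Un)
    qed
    ultimately have "?r - j \<le> card ?T" using r by simp
    also have "?T = (\<Union>i<q. ?T \<inter> ?N i)"
      using edgesK cover by auto
    also have "card \<dots> \<le> (\<Sum>i<q. card (?T \<inter> ?N i))"
      by (rule card_UN_le) simp
    also have "\<dots> \<le> (\<Sum>i<q. card {e \<in> edges G. c e = j})"
    proof (rule sum_mono)
      fix i assume "i \<in> {..<q}"
      then have "pairwise disjnt (?T \<inter> ?N i)"
        using matchK pairwise_subset by (metis inf_le2 lessThan_iff)
      then show "card (?T \<inter> ?N i) \<le> card {e \<in> edges G. c e = j}"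
        using KG by (intro max[rule_format] conjI) auto
    qed
    finally show ?thesis by simp
  qed
  have "(?r + 1) choose 2 = (\<Sum>j<?r. ?r - j)"
    by (simp only: sum_diff_choose_two)
  also have "\<dots> \<le> (\<Sum>j<?r. q * card {e \<in> edges G. c e = j})"
    by (intro sum_mono large)
  \<comment> \<open>Distinct colors have disjoint classes. Edges of color at least \<open>?r\<close>
    are lost only in the next inequality.\<close>
  also have "\<dots> = q * card (\<Union>j<?r. {e \<in> edges G. c e = j})"
    using finG by (subst card_UN_disjoint) (auto simp: sum_distrib_left)
  also have "\<dots> \<le> q * card (edges G)"
    using finG by (intro mult_le_mono2 card_mono) auto
  finally show ?thesis .
qed

text \<open>\<open>LEAST\<close> carries information only if some graph qualifies. Hence the lower
  bounds below also assume a forcing graph, which the constructions for the upper bounds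
  supply.\<close>

lemma AR_s_attained:
  assumes "simple_graph G" "forces_rainbow G H"
  obtains G' where "simple_graph G'" "card (edges G') = AR_s H" "forces_rainbow G' H"
proof -
  have "\<exists>m. \<exists>G::nat ugraph. simple_graph G \<and> card (edges G) = m \<and> forces_rainbow G H"
    using assms by blast
  from LeastI_ex[OF this] show ?thesis
    using that unfolding AR_s_def by blast
qed

lemma AR_s_le:
  assumes "simple_graph G" "forces_rainbow G H"
  shows "AR_s H \<le> card (edges G)"
  unfolding AR_s_def using assms by (intro Least_le) blast

lemma AR_s_path_graph_ge:
  assumes "simple_graph G" "forces_rainbow G (path_graph n)"
  shows "(n + 1) choose 2 \<le> 2 * AR_s (path_graph n)"
proof -
  let ?e = "\<lambda>i::nat. {i, i + 1}"
  have simple: "simple_graph (path_graph n)"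
    by (auto simp: simple_graph_def path_graph_def)
  have edges: "edges (path_graph n) = ?e ` {..<n}"
    by (auto simp: path_graph_def)
  have "inj_on ?e {..<n}"
    by (auto simp: inj_on_def doubleton_eq_iff)
  then have card: "card (edges (path_graph n)) = n"
    by (simp add: edges card_image)
  \<comment> \<open>Edges of the path whose left endpoints have equal parity never meet, which gives
    two matchings.\<close>
  let ?N = "\<lambda>j. ?e ` {i. i < n \<and> i mod 2 = j}"
  have cover: "edges (path_graph n) = (\<Union>j<2. ?N j)"
  proof
    show "edges (path_graph n) \<subseteq> (\<Union>j<2. ?N j)"
    proof
      fix e assume "e \<in> edges (path_graph n)"
      then obtain i where "e = ?e i" "i < n" by (auto simp: edges)
      then have "e \<in> ?N (i mod 2)" by blast
      then show "e \<in> (\<Union>j<2. ?N j)" by (intro UN_I[of "i mod 2"]) auto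
    qed
  qed (auto simp: edges)
  have match: "pairwise disjnt (?N j)" for j
  proof (rule pairwiseI)
    fix x y assume "x \<in> ?N j" "y \<in> ?N j" "x \<noteq> y"
    then obtain a b where ab: "x = ?e a" "y = ?e b" "a mod 2 = j" "b mod 2 = j"
      by blast
    with \<open>x \<noteq> y\<close> have "a \<noteq> b" by auto
    moreover have "a \<noteq> b + 1" "b \<noteq> a + 1" using ab by presburger+
    ultimately show "disjnt x y" using ab by (auto simp: disjnt_def)
  qed
  obtain G' :: "nat ugraph" where G': "simple_graph G'" "card (edges G') = AR_s (path_graph n)"
    "forces_rainbow G' (path_graph n)"
    using AR_s_attained[OF assms] .
  show ?thesis
    using forces_rainbow_card_edges[OF G'(1,3) simple cover match] by (simp add: card G'(2))
qed

lemma simple_graph_matching_graph: "simple_graph (matching_graph n)"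
  by (auto simp: simple_graph_def matching_graph_def)

lemma AR_s_matching_graph_ge:
  assumes "simple_graph G" "forces_rainbow G (matching_graph n)"
  shows "(n + 1) choose 2 \<le> AR_s (matching_graph n)"
proof -
  let ?e = "\<lambda>i::nat. {2 * i, 2 * i + 1}"
  have edges: "edges (matching_graph n) = ?e ` {..<n}"
    by (auto simp: matching_graph_def)
  have "inj_on ?e {..<n}"
    by (auto simp: inj_on_def doubleton_eq_iff)
  then have card: "card (edges (matching_graph n)) = n"
    by (simp add: edges card_image)
  have cover: "edges (matching_graph n) = (\<Union>j<(1::nat). edges (matching_graph n))"
    by auto
  have match: "pairwise disjnt (edges (matching_graph n))"
  proof (rule pairwiseI)
    fix x y assume "x \<in> edges (matching_graph n)" "y \<in> edges (matching_graph n)" "x \<noteq> y"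
    then obtain a b where ab: "x = ?e a" "y = ?e b" "a \<noteq> b"
      by (auto simp: edges)
    then have "2 * a \<noteq> 2 * b + 1" "2 * b \<noteq> 2 * a + 1" by presburger+
    with ab show "disjnt x y" by (auto simp: disjnt_def)
  qed
  obtain G' :: "nat ugraph" where G': "simple_graph G'"
    "card (edges G') = AR_s (matching_graph n)" "forces_rainbow G' (matching_graph n)"
    using AR_s_attained[OF assms] .
  show ?thesis
    using forces_rainbow_card_edges[OF G'(1,3) simple_graph_matching_graph cover match]
    by (simp add: card G'(2))
qed

section \<open>Upper bound for matchings\<close>

text \<open>Greedy: the \<open>i\<close> values chosen earlier cannot exhaust \<open>A i\<close>.
  Below, \<open>A i\<close> is the set of colors on star \<open>i\<close>.\<close>

lemma distinct_choice:
  assumes "\<And>i. i < n \<Longrightarrow> finite (A i) \<and> i < card (A i)"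
  shows "\<exists>s. (\<forall>i<n. s i \<in> A i) \<and> inj_on s {..<n}"
  using assms
proof (induction n)
  case (Suc n)
  have "finite (A i) \<and> i < card (A i)" if "i < n" for i
    using Suc.prems that by simp
  from Suc.IH[OF this] obtain s where s: "\<forall>i<n. s i \<in> A i" "inj_on s {..<n}"
    by blast
  have "card (s ` {..<n}) \<le> n"
    using card_image_le[of "{..<n}" s] by simp
  moreover have "n < card (A n)"
    using Suc.prems by simp
  ultimately have "\<not> A n \<subseteq> s ` {..<n}"
    using card_mono[of "s ` {..<n}" "A n"] by (meson finite_imageI finite_lessThan leD le_trans)
  then obtain x where "x \<in> A n" "x \<notin> s ` {..<n}" by blast
  with s have "\<forall>i<Suc n. (s(n := x)) i \<in> A i"
    by (simp add: less_Suc_eq)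
  moreover have "inj_on (s(n := x)) {..<Suc n}"
    using inj_on_fun_updI[OF s(2) \<open>x \<notin> _\<close>, of n] \<open>x \<notin> _\<close>
    by (simp add: lessThan_Suc)
  ultimately have "(\<forall>i<Suc n. (s(n := x)) i \<in> A i) \<and> inj_on (s(n := x)) {..<Suc n}" ..
  then show ?case by - (rule exI[of _ "s(n := x)"])
qed simp

text \<open>Vertices must be natural numbers, so pairs are encoded: second component 0 marks the
  center of star \<open>i\<close>, and \<open>Suc t\<close> its leaf \<open>t\<close>.\<close>

definition star_edge :: "nat \<Rightarrow> nat \<Rightarrow> nat set" where
  "star_edge i t = {prod_encode (i, 0), prod_encode (i, Suc t)}"

definition star_forest :: "nat \<Rightarrow> nat ugraph" where
  "star_forest n = \<lparr>verts = prod_encode ` ({..<n} \<times> {..n}),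
     edges = (\<lambda>(i, t). star_edge i t) ` (SIGMA i:{..<n}. {..i})\<rparr>"

lemma star_edge_eq_iff: "star_edge i t = star_edge j u \<longleftrightarrow> i = j \<and> t = u"
  by (auto simp: star_edge_def doubleton_eq_iff)

lemma simple_graph_star_forest: "simple_graph (star_forest n)"
  by (auto simp: simple_graph_def star_forest_def star_edge_def)

lemma card_edges_star_forest: "card (edges (star_forest n)) = (n + 1) choose 2"
proof -
  have "inj_on (\<lambda>(i, t). star_edge i t) (SIGMA i:{..<n}. {..i})"
    by (auto simp: inj_on_def star_edge_eq_iff)
  then have "card (edges (star_forest n)) = (\<Sum>i<n. Suc i)"
    by (simp add: star_forest_def card_image)
  also have "\<dots> = (n + 1) choose 2"
    by (induction n) (simp_all add: numeral_2_eq_2)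
  finally show ?thesis .
qed

text \<open>Edges of one star meet, so star \<open>i\<close> shows \<open>i + 1\<close> colors.
  Distinct representatives of these color sets pick one edge per star, and edges of different stars
  are disjoint.\<close>

lemma forces_rainbow_star_forest: "forces_rainbow (star_forest n) (matching_graph n)"
  unfolding forces_rainbow_def
proof (intro allI impI)
  fix c :: "nat set \<Rightarrow> nat"
  assume proper: "proper_edge_coloring (star_forest n) c"
  have edge: "star_edge i t \<in> edges (star_forest n)" if "i < n" "t \<le> i" for i t
    using that by (force simp: star_forest_def)
  have "inj_on (\<lambda>t. c (star_edge i t)) {..i}" if "i < n" for i
  proof (rule inj_onI, rule ccontr)
    fix t u assume "t \<in> {..i}" "u \<in> {..i}" "c (star_edge i t) = c (star_edge i u)" "t \<noteq> u"
    moreover have "star_edge i t \<inter> star_edge i u \<noteq> {}"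
      by (auto simp: star_edge_def)
    ultimately show False
      using proper edge that star_edge_eq_iff unfolding proper_edge_coloring_def
      by (metis atMost_iff)
  qed
  then have "\<exists>s. (\<forall>i<n. s i \<in> (\<lambda>t. c (star_edge i t)) ` {..i}) \<and> inj_on s {..<n}"
    by (intro distinct_choice) (simp add: card_image)
  then obtain s where s: "\<forall>i<n. s i \<in> (\<lambda>t. c (star_edge i t)) ` {..i}" "inj_on s {..<n}"
    by blast
  then have "\<forall>i<n. \<exists>t\<le>i. s i = c (star_edge i t)" by fastforce
  then obtain t where t: "\<And>i. i < n \<Longrightarrow> t i \<le> i" "\<And>i. i < n \<Longrightarrow> s i = c (star_edge i (t i))"
    by metis
  \<comment> \<open>The matching edge \<open>{2 * i, 2 * i + 1}\<close> goes to the chosen edge of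
    star \<open>i\<close>, its even end to the center.\<close>
  let ?g = "\<lambda>p. prod_encode (p div 2, if even p then 0 else Suc (t (p div 2)))"
  have "edges (matching_graph n) = (\<lambda>i. {2 * i, 2 * i + 1}) ` {..<n}"
    by (auto simp: matching_graph_def)
  moreover have "?g ` {2 * i, 2 * i + 1} = star_edge i (t i)" for i
    by (simp add: star_edge_def)
  ultimately have edges: "(`) ?g ` edges (matching_graph n) = (\<lambda>i. star_edge i (t i)) ` {..<n}"
    by (simp only: image_image)
  have "inj_on ?g (verts (matching_graph n))"
  proof (rule inj_onI)
    fix p q assume "?g p = ?g q"
    then have "p div 2 = q div 2" "even p \<longleftrightarrow> even q"
      by (simp_all split: if_splits)
    then show "p = q" by presburger
  qed
  moreover have "?g ` verts (matching_graph n) \<subseteq> verts (star_forest n)"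
  proof (rule image_subsetI)
    fix p assume "p \<in> verts (matching_graph n)"
    then have "p div 2 < n" by (auto simp: matching_graph_def)
    with t(1)[OF this] have "(p div 2, if even p then 0 else Suc (t (p div 2))) \<in> {..<n} \<times> {..n}"
      by simp
    then show "?g p \<in> verts (star_forest n)"
      by (simp only: star_forest_def ugraph.simps) (rule imageI)
  qed
  ultimately have "is_copy (map_graph ?g (matching_graph n)) (matching_graph n) (star_forest n)"
    using t edge by (intro is_copy_map_graph simple_graph_matching_graph) (auto simp: edges)
  moreover have "rainbow (map_graph ?g (matching_graph n)) c"
    unfolding rainbow_def
    using s(2) t(2) by (auto simp: map_graph_def edges inj_on_def)
  ultimately show "\<exists>K. is_copy K (matching_graph n) (star_forest n) \<and> rainbow K c" by blast
qed

section \<open>Upper bound for cycles\<close>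

text \<open>The vertices \<open>2 i < k\<close> are the even positions of the future cycle; the vertices from \<open>k\<close>
  on are the candidates for its odd positions.\<close>

definition cycle_host :: "nat \<Rightarrow> nat ugraph" where
  "cycle_host k = (let h = k div 2 in \<lparr>verts = {..<k + 5 * h},
     edges = (\<lambda>(i, t). {2 * i, k + t}) ` (SIGMA i:{1..<h}. {..<5 * i + 3})
       \<union> (\<lambda>t. {0, k + t}) ` {..<5 * h - 2}
       \<union> (if odd k then insert {k - 1, 0} ((\<lambda>t. {k - 1, k + t}) ` {..<5 * h - 2}) else {})\<rparr>)"

lemma simple_graph_cycle_host:
  assumes "k \<ge> 3"
  shows "simple_graph (cycle_host k)"
  using assms by (auto simp: simple_graph_def cycle_host_def Let_def card_insert_if split: if_splits)

lemma card_edges_cycle_host: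
  assumes "k \<ge> 3"
  shows "card (edges (cycle_host k)) \<le> k ^ 2"
proof -
  define h where "h = k div 2"
  have h: "h \<ge> 1" using assms by (simp add: h_def)
  let ?A = "(\<lambda>(i, t). {2 * i, k + t}) ` (SIGMA i:{1..<h}. {..<5 * i + 3})"
  let ?B = "(\<lambda>t. {0, k + t}) ` {..<5 * h - 2}"
  let ?C = "(\<lambda>t. {k - 1, k + t}) ` {..<5 * h - 2}"
  define S where "S = (\<Sum>i\<in>{1..<h}. 5 * i + 3)"
  have A: "card ?A \<le> S"
    using card_image_le[of "SIGMA i:{1..<h}. {..<5 * i + 3}" "\<lambda>(i, t). {2 * i, k + t}"]
    by (simp add: S_def)
  have B: "card ?B \<le> 5 * h - 2" and C: "card ?C \<le> 5 * h - 2"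
    using card_image_le[of "{..<5 * h - 2}"] by (metis card_lessThan finite_lessThan)+
  have AB: "card (?A \<union> ?B) \<le> S + (5 * h - 2)"
    using card_Un_le[of ?A ?B] A B by linarith
  \<comment> \<open>Doubled and with 6 moved to the left, the closed form of the sum avoids division
    and truncated subtraction.\<close>
  have s: "2 * S + 6 = 5 * h\<^sup>2 + h"
    unfolding S_def using h by (induction h rule: dec_induct) (auto simp: power2_eq_square algebra_simps)
  show ?thesis
  proof (cases "even k")
    case True
    then have k: "k = 2 * h" by (simp add: h_def)
    \<comment> \<open>This turns \<open>5 * h - 2\<close> into a true polynomial in
      \<open>d\<close>. The final estimate is an equality at \<open>d = 0\<close>, here and in the
      odd case.\<close>
    then obtain d where d: "h = 2 + d"
      using assms le_Suc_ex[of 2 h] by auto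
    have "d \<le> d * d" by (cases d) auto
    moreover have "2 * S = 16 + 5 * (d * d) + 21 * d"
      using s by (simp add: d power2_eq_square algebra_simps)
    ultimately have "S + (5 * h - 2) \<le> 16 + 16 * d + 4 * (d * d)"
      using d by linarith
    also have "\<dots> = k ^ 2"
      by (simp add: k d power2_eq_square algebra_simps)
    finally have "S + (5 * h - 2) \<le> k ^ 2" .
    moreover have "edges (cycle_host k) = ?A \<union> ?B"
      using True by (simp add: cycle_host_def Let_def h_def)
    ultimately show ?thesis using AB by simp
  next
    case False
    then have k: "k = 2 * h + 1" by (simp add: h_def)
    have "S + (5 * h - 2) + Suc (5 * h - 2) \<le> k ^ 2"
    \<comment> \<open>This is \<open>k = 3\<close>, where the substitution \<open>h = 2 + d\<close>
      is impossible; the bound reads 7 against 9.\<close>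
    proof (cases "h = 1")
      case True
      then show ?thesis using s by (simp add: k)
    next
      case False
      then obtain d where d: "h = 2 + d"
        using h le_Suc_ex[of 2 h] by auto
      have "d \<le> d * d" by (cases d) auto
      moreover have "2 * S = 16 + 5 * (d * d) + 21 * d"
        using s by (simp add: d power2_eq_square algebra_simps)
      ultimately have "S + (5 * h - 2) + Suc (5 * h - 2) \<le> 25 + 20 * d + 4 * (d * d)"
        using d by linarith
      also have "\<dots> = k ^ 2"
        by (simp add: k d power2_eq_square algebra_simps)
      finally show ?thesis .
    qed
    moreover have "edges (cycle_host k) = (?A \<union> ?B) \<union> insert {k - 1, 0} ?C"
      using False by (simp add: cycle_host_def Let_def h_def)
    moreover have "card (insert {k - 1, 0} ?C) \<le> Suc (5 * h - 2)"
      using card_insert_le_m1[of "Suc (5 * h - 2)" ?C "{k - 1, 0}"] C by simp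
    moreover note AB card_Un_le[of "?A \<union> ?B" "insert {k - 1, 0} ?C"]
    ultimately show ?thesis by simp
  qed
qed

section \<open>Rainbow cycles in the host graph\<close>

lemma proper_edge_coloringD:
  assumes "proper_edge_coloring G c" "e \<in> edges G" "e' \<in> edges G" "e \<noteq> e'" "e \<inter> e' \<noteq> {}"
  shows "c e \<noteq> c e'"
  using assms by (auto simp: proper_edge_coloring_def)

text \<open>Colors at a vertex are distinct, so each of \<open>x\<close> and \<open>y\<close> rules
  out at most \<open>card F\<close> candidates \<open>b\<close>, and \<open>W\<close> (vertices
  already used) rules out \<open>card W\<close> more. The two new edges meet in \<open>b\<close>, so
  they differ in color.\<close>

lemma rainbow_extension:
  assumes proper: "proper_edge_coloring G c" and F: "finite F" "F \<subseteq> edges G" "inj_on c F"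
    and xy: "x \<noteq> y" "x \<notin> B" "y \<notin> B"
    and B: "\<And>b. b \<in> B \<Longrightarrow> {x, b} \<in> edges G" "\<And>b. b \<in> B \<Longrightarrow> {y, b} \<in> edges G"
    and card: "finite B" "finite W" "2 * card F + card W < card B"
  obtains b where "b \<in> B" "b \<notin> W" "inj_on c (insert {x, b} (insert {y, b} F))"
proof -
  have bad: "card {b \<in> B. c {z, b} \<in> c ` F} \<le> card F"
    if z: "z \<notin> B" "\<And>b. b \<in> B \<Longrightarrow> {z, b} \<in> edges G" for z
  proof -
    have "inj_on (\<lambda>b. c {z, b}) B"
    proof (rule inj_onI, rule ccontr)
      fix a b assume ab: "a \<in> B" "b \<in> B" "c {z, a} = c {z, b}" "a \<noteq> b"
      then have "{z, a} \<noteq> {z, b}" by (auto simp: doubleton_eq_iff)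
      then have "c {z, a} \<noteq> c {z, b}"
        using ab z(2) by (intro proper_edge_coloringD[OF proper]) auto
      with ab show False by simp
    qed
    then have "card {b \<in> B. c {z, b} \<in> c ` F} \<le> card (c ` F)"
      using F(1) by (intro card_inj_on_le[of "\<lambda>b. c {z, b}"]) (auto simp: inj_on_def)
    then show ?thesis
      using card_image_le[OF F(1), of c] by simp
  qed
  let ?bad = "{b \<in> B. c {x, b} \<in> c ` F} \<union> {b \<in> B. c {y, b} \<in> c ` F} \<union> W"
  have "card ?bad \<le> card {b \<in> B. c {x, b} \<in> c ` F} + card {b \<in> B. c {y, b} \<in> c ` F} + card W"
    by (rule order_trans[OF card_Un_le add_right_mono[OF card_Un_le]])
  also have "\<dots> < card B"
    using bad[OF xy(2) B(1)] bad[OF xy(3) B(2)] card(3) by linarith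
  finally have "card ?bad < card B" .
  moreover have "finite ?bad" using card(1,2) by simp
  ultimately have "\<not> B \<subseteq> ?bad"
    using card_mono[of ?bad B] by linarith
  then obtain b where b: "b \<in> B" "c {x, b} \<notin> c ` F" "c {y, b} \<notin> c ` F" "b \<notin> W"
    by blast
  moreover have "c {x, b} \<noteq> c {y, b}"
    using B b(1) xy by (intro proper_edge_coloringD[OF proper]) (auto simp: doubleton_eq_iff)
  ultimately have "inj_on c (insert {x, b} (insert {y, b} F))"
    using F(3) by auto
  with b show ?thesis by (intro that)
qed

lemma simple_graph_cycle_graph:
  assumes "k \<ge> 3"
  shows "simple_graph (cycle_graph k)"
proof -
  have "i \<noteq> (i + 1) mod k" if "i < k" for i
    using that assms by (cases "i + 1 = k") auto
  then show ?thesis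
    using assms by (auto simp: simple_graph_def cycle_graph_def card_2_iff)
qed

lemma subgraph_path_graph_cycle_graph:
  assumes "n < k"
  shows "subgraph (path_graph n) (cycle_graph k)"
proof -
  have "\<exists>j. {i, Suc i} = {j, Suc j mod k} \<and> j < k" if "i < n" for i
    using that assms by (intro exI[of _ i]) auto
  then show ?thesis
    using assms by (auto simp: subgraph_def simple_graph_def path_graph_def cycle_graph_def)
qed

text \<open>This explains the degrees in \<open>cycle_host\<close>. Step \<open>i\<close> fills
  position \<open>2 * i + 1\<close>. At most \<open>2 * i + 1\<close> edges are then present and
  \<open>i\<close> candidates used, so at most \<open>2 * (2 * i + 1) + i = 5 * i + 2\<close>
  choices fail and \<open>5 * i + 3\<close> suffice. The vertices closing the cycle take part in
  step \<open>h - 1\<close>, which requires \<open>5 * (h - 1) + 3 = 5 * h - 2\<close>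
  neighbors.\<close>

lemma forces_rainbow_cycle_host:
  assumes k: "k \<ge> 3"
  shows "forces_rainbow (cycle_host k) (cycle_graph k)"
  unfolding forces_rainbow_def
proof (intro allI impI)
  fix c :: "nat set \<Rightarrow> nat"
  assume proper: "proper_edge_coloring (cycle_host k) c"
  define h where "h = k div 2"
  have kh: "2 * h \<le> k" "k \<le> 2 * h + 1" "h \<ge> 1"
    using k by (auto simp: h_def)
  let ?E = "edges (cycle_host k)"
  \<comment> \<open>For odd \<open>k\<close> the consecutive positions \<open>k - 1\<close> and
    \<open>0\<close> are both even, so their edge is fixed from the start. \<open>F b i\<close>
    consists of \<open>E0\<close> and the edges at the first \<open>i\<close> odd positions,
    position \<open>2 * j + 1\<close> being filled by \<open>k + b j\<close>.\<close>
  define E0 where "E0 = (if odd k then {{k - 1, 0}} else {})"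
  define F where "F b i = E0 \<union> (\<lambda>j. {2 * j, k + b j}) ` {..<i}
    \<union> (\<lambda>j. {(2 * j + 2) mod k, k + b j}) ` {..<i}" for b i
  have E: "?E = (\<lambda>(i, t). {2 * i, k + t}) ` (SIGMA i:{1..<h}. {..<5 * i + 3})
       \<union> (\<lambda>t. {0, k + t}) ` {..<5 * h - 2}
       \<union> (if odd k then insert {k - 1, 0} ((\<lambda>t. {k - 1, k + t}) ` {..<5 * h - 2}) else {})"
    by (simp add: cycle_host_def Let_def h_def)
  have E0: "E0 \<subseteq> ?E" by (auto simp: E E0_def)
  have inner: "{2 * j, k + t} \<in> ?E" if "1 \<le> j" "j < h" "t < 5 * j + 3" for j t
  proof -
    have "(j, t) \<in> (SIGMA i:{1..<h}. {..<5 * i + 3})" using that by simp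
    then show ?thesis by (force simp: E)
  qed
  have left: "{2 * j, k + t} \<in> ?E" if "j < h" "t < 5 * j + 3" for j t
  proof (cases "j = 0")
    case True
    with that have "t \<in> {..<5 * h - 2}" by simp
    with True show ?thesis by (simp add: E)
  qed (use inner that in simp)
  \<comment> \<open>The right neighbor is the next inner even position, or in the last step
    \<open>0\<close> for even \<open>k\<close> and \<open>k - 1\<close> for odd
    \<open>k\<close>.\<close>
  have right: "{(2 * j + 2) mod k, k + t} \<in> ?E" if j: "j < h" "t < 5 * j + 3" for j t
  proof (cases "j + 1 < h")
    case True
    then have "(2 * j + 2) mod k = 2 * (j + 1)" using kh by simp
    then show ?thesis using inner[of "j + 1" t] True j by simp
  next
    case False
    with j have jh: "h = j + 1" by simp
    with j have t: "t \<in> {..<5 * h - 2}" by simp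
    show ?thesis
    proof (cases "even k")
      case True
      with jh have "(2 * j + 2) mod k = 0" by (auto simp: h_def)
      with t show ?thesis by (simp add: E)
    next
      case odd: False
      with jh have "k = 2 * j + 3" unfolding h_def by presburger
      then have "(2 * j + 2) mod k = k - 1" by simp
      with t odd show ?thesis by (simp add: E)
    qed
  qed
  have "\<exists>b. (\<forall>j<i. b j < 5 * j + 3) \<and> inj_on b {..<i} \<and> inj_on c (F b i)" if "i \<le> h" for i
    using that
  proof (induction i)
    case 0
    then show ?case by (auto simp: F_def E0_def)
  next
    case (Suc i)
    then have i: "i < h" by simp
    from Suc obtain b where b: "\<And>j. j < i \<Longrightarrow> b j < 5 * j + 3" "inj_on b {..<i}"
      "inj_on c (F b i)" by auto
    let ?x = "2 * i" and ?y = "(2 * i + 2) mod k"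
    let ?B = "(+) k ` {..<5 * i + 3}" and ?W = "(\<lambda>j. k + b j) ` {..<i}"
    have finF: "finite (F b i)" by (simp add: F_def E0_def)
    have "F b i \<subseteq> ?E"
      using E0 left right b(1) i by (auto simp: F_def)
    moreover have "card (F b i) \<le> 1 + i + i"
    proof -
      have "card E0 \<le> 1" by (simp add: E0_def)
      moreover have "card ((\<lambda>j. {2 * j, k + b j}) ` {..<i}) \<le> i"
        "card ((\<lambda>j. {(2 * j + 2) mod k, k + b j}) ` {..<i}) \<le> i"
        using card_image_le[of "{..<i}"] by (metis card_lessThan finite_lessThan)+
      ultimately show ?thesis
        unfolding F_def by (meson add_mono card_Un_le le_trans)
    qed
    moreover have "card ?W \<le> i"
      using card_image_le[of "{..<i}" "\<lambda>j. k + b j"] by simp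
    moreover have "card ?B = 5 * i + 3"
      by (simp add: card_image)
    \<comment> \<open>The two neighbors could coincide only by wrapping around at
      \<open>i = 0\<close>, which means \<open>k = 2\<close>.\<close>
    moreover have "?x \<noteq> ?y"
    proof (cases "2 * i + 2 < k")
      case False
      with i kh have "k = 2 * i + 2" by simp
      with k show ?thesis by simp
    qed simp
    moreover have "?x \<notin> ?B" using i kh by auto
    moreover have "?y \<notin> ?B"
    proof -
      have "?y < k" using k by simp
      then show ?thesis by auto
    qed
    ultimately obtain v where v: "v \<in> ?B" "v \<notin> ?W"
        "inj_on c (insert {?x, v} (insert {?y, v} (F b i)))"
      using left[OF i] right[OF i] b(3) finF
      by (elim rainbow_extension[OF proper, of "F b i" ?x ?y ?B ?W, rotated -1]) auto
    from v(1) obtain t where t: "v = k + t" "t < 5 * i + 3" by auto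
    let ?b = "b(i := t)"
    have eq: "(\<lambda>j. f j (?b j)) ` {..<Suc i} = insert (f i t) ((\<lambda>j. f j (b j)) ` {..<i})"
      for f :: "nat \<Rightarrow> nat \<Rightarrow> nat set"
      by (simp add: lessThan_Suc)
    have "F ?b (Suc i) = insert {?x, v} (insert {?y, v} (F b i))"
      unfolding F_def t(1) eq[of "\<lambda>j s. {2 * j, k + s}"] eq[of "\<lambda>j s. {(2 * j + 2) mod k, k + s}"]
      by auto
    moreover have "inj_on ?b {..<Suc i}"
      using b(2) v(2) t(1) by (auto simp: lessThan_Suc inj_on_def)
    moreover have "\<forall>j<Suc i. ?b j < 5 * j + 3"
      using b(1) t(2) by (simp add: less_Suc_eq)
    ultimately have "(\<forall>j<Suc i. ?b j < 5 * j + 3) \<and> inj_on ?b {..<Suc i} \<and> inj_on c (F ?b (Suc i))"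
      using v(3) by (simp only: simp_thms)
    then show ?case by - (rule exI[of _ ?b])
  qed
  then obtain b where b: "\<And>j. j < h \<Longrightarrow> b j < 5 * j + 3" "inj_on b {..<h}" "inj_on c (F b h)"
    by blast
  let ?g = "\<lambda>p. if even p then p else k + b (p div 2)"
  have odd_less: "p div 2 < h" if "odd p" "p < k" for p
    using that kh by (auto elim!: oddE)
  have edge: "?g ` {p, (p + 1) mod k} \<in> F b h" if p: "p < k" for p
  proof (cases "even p")
    case True
    then obtain j where j: "p = 2 * j" by (auto elim: evenE)
    show ?thesis
    proof (cases "p + 1 < k")
      case True
      with j kh have "j < h" by simp
      with True j show ?thesis by (auto simp: F_def)
    \<comment> \<open>An even last position occurs only for odd \<open>k\<close>; its edge to
      \<open>0\<close> is the one in \<open>E0\<close>.\<close>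
    next
      case False
      with p have "k = p + 1" by simp
      with j show ?thesis by (simp add: F_def E0_def)
    qed
  next
    case False
    then obtain j where j: "p = 2 * j + 1" by (auto elim: oddE)
    have "j < h" using odd_less[OF False p] j by simp
    moreover have "even ((2 * j + 2) mod k)"
    proof (cases "p + 1 < k")
      case False
      with p j have "k = 2 * j + 2" by simp
      then show ?thesis by simp
    qed (simp add: j)
    ultimately show ?thesis using j by (auto simp: F_def insert_commute)
  qed
  have edges: "(`) ?g ` edges (cycle_graph k) \<subseteq> F b h"
    using edge by (auto simp: cycle_graph_def)
  have "inj_on ?g {..<k}"
  proof (rule inj_onI)
    fix p q assume pq: "p \<in> {..<k}" "q \<in> {..<k}" "?g p = ?g q"
    show "p = q"
    \<comment> \<open>Even positions keep values below \<open>k\<close>, odd ones move to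
      \<open>k\<close> or above, so only two odd positions need injectivity of
      \<open>b\<close>.\<close>
    proof (cases "even p \<or> even q")
      case True
      with pq show ?thesis by (auto split: if_splits)
    next
      case False
      with pq have "b (p div 2) = b (q div 2)" by simp
      with False pq have "p div 2 = q div 2"
        using inj_onD[OF b(2)] odd_less by simp
      with False show ?thesis by (metis odd_two_times_div_two_succ)
    qed
  qed
  moreover have "?g ` {..<k} \<subseteq> verts (cycle_host k)"
  proof -
    have "b (p div 2) < 5 * h" if "odd p" "p < k" for p
      using b(1)[OF odd_less[OF that]] odd_less[OF that] by linarith
    then show ?thesis
      by (auto simp: cycle_host_def Let_def h_def)
  qed
  moreover have "verts (cycle_graph k) = {..<k}"
    by (auto simp: cycle_graph_def)
  moreover have "F b h \<subseteq> ?E"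
    using E0 left right b(1) by (auto simp: F_def)
  ultimately have "is_copy (map_graph ?g (cycle_graph k)) (cycle_graph k) (cycle_host k)"
    using edges by (intro is_copy_map_graph simple_graph_cycle_graph[OF k]) auto
  moreover have "rainbow (map_graph ?g (cycle_graph k)) c"
    unfolding rainbow_def using edges inj_on_subset[OF b(3)] by (simp add: map_graph_def)
  ultimately show "\<exists>K. is_copy K (cycle_graph k) (cycle_host k) \<and> rainbow K c" by blast
qed

section \<open>Combination of the bounds\<close>

theorem theorem6:
  shows "(\<forall>k::nat. k \<ge> 2 \<longrightarrow>
            real k * (real k - 1) / 4 \<le> real (AR_s (path_graph (k - 1))) \<and>
            AR_s (matching_graph k) = (k + 1) choose 2) \<and>
         (\<forall>k::nat. k \<ge> 3 \<longrightarrow>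
            AR_s (path_graph (k - 1)) \<le> AR_s (cycle_graph k) \<and>
            AR_s (cycle_graph k) \<le> k ^ 2)"
proof (intro conjI allI impI)
  have path: "forces_rainbow G (path_graph n)"
    if "forces_rainbow G (cycle_graph k)" "n < k" "k \<ge> 3" for G n k
    using that forces_rainbow_subgraph subgraph_path_graph_cycle_graph simple_graph_cycle_graph
    by blast
  fix k :: nat
  {
    assume k: "k \<ge> 2"
    \<comment> \<open>The longer cycle is used because \<open>k = 2\<close> is allowed here and the
      host results start at 3; any forcing graph serves to make \<open>AR_s\<close>
      attained.\<close>
    have "forces_rainbow (cycle_host (k + 1)) (path_graph (k - 1))"
      using k by (intro path[of _ "k + 1"] forces_rainbow_cycle_host) auto
    then have "(k - 1 + 1) choose 2 \<le> 2 * AR_s (path_graph (k - 1))"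
      using k by (intro AR_s_path_graph_ge[of "cycle_host (k + 1)"] simple_graph_cycle_host) auto
    then have "real (k choose 2) \<le> 2 * real (AR_s (path_graph (k - 1)))"
      using k by simp
    moreover have "real (k choose 2) = real k * (real k - 1) / 2"
      using k by (simp add: choose_two real_of_nat_div of_nat_diff)
    ultimately show "real k * (real k - 1) / 4 \<le> real (AR_s (path_graph (k - 1)))"
      by simp
    note star = simple_graph_star_forest forces_rainbow_star_forest
    show "AR_s (matching_graph k) = (k + 1) choose 2"
      using AR_s_le[OF star, of k] AR_s_matching_graph_ge[OF star, of k]
      by (simp add: card_edges_star_forest)
  next
    assume k: "k \<ge> 3"
    note host = simple_graph_cycle_host[OF k] forces_rainbow_cycle_host[OF k]
    show "AR_s (cycle_graph k) \<le> k ^ 2"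
      using AR_s_le[OF host] card_edges_cycle_host[OF k] by linarith
    \<comment> \<open>An optimal graph for the cycle also forces the path contained in it.\<close>
    obtain G where G: "simple_graph G" "card (edges G) = AR_s (cycle_graph k)"
      "forces_rainbow G (cycle_graph k)"
      using AR_s_attained[OF host] .
    have "forces_rainbow G (path_graph (k - 1))"
      using G(3) k by (intro path) auto
    then show "AR_s (path_graph (k - 1)) \<le> AR_s (cycle_graph k)"
      using AR_s_le[OF G(1)] G(2) by simp
  }
qed

end
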